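(* In the setting of the context, let $\gamma>0$, $\kappa\in(0,1]$, and let $x_k\in\mathcal X$ and $\Lambda_k$ ($k\ge0$) be iterates of the inexact primal-dual scheme. The optimal solution of the dual update problem $$\min_{\Lambda\in\mathcal V}\Big[\gamma\big(\langle\Lambda-\Lambda_k,-G(x_k)\rangle+\kappa B(\Lambda,\Lambda_u)\big)+B(\Lambda,\Lambda_k)\Big]$$ is the measure $\Lambda_{k+1}$ with Lebesgue density $$\Lambda_{k+1}(\xi)=\min\left\{\frac{\bar\rho(\theta)}{\left(\rho_0/\mathrm{vol}(\Xi)\right)^{\frac{\gamma\kappa}{1+\gamma\kappa}}\int_\Xi\exp\left(\frac{\gamma g(x_k,\xi')}{1+\gamma\kappa}\right)\Lambda_k(\xi')^{\frac1{1+\gamma\kappa}}d\xi'},\,1\right\}\left(\rho_0/\mathrm{vol}(\Xi)\right)^{\frac{\gamma\kappa}{1+\gamma\kappa}}\exp\left(\frac{\gamma g(x_k,\xi)}{1+\gamma\kappa}\right)\Lambda_k(\xi)^{\frac1{1+\gamma\kappa}}$$ for all $\xi\in\Xi$.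
   Context: $\mathcal X\subset\mathbb R^m$ is convex and compact; $f:\mathcal X\to\mathbb R$ is convex, $L_f$-Lipschitz and differentiable; $\Xi\subset\mathbb R^d$ is compact, convex and full-dimensional; $g:\mathcal X\times\Xi\to\mathbb R$ is such that for every $\xi\in\Xi$ the map $x\mapsto g(x,\xi)$ is convex, $L_{g,\mathcal X}$-Lipschitz (uniformly in $\xi$) and continuously differentiable, and for every $x$ the map $\xi\mapsto g(x,\xi)$ is $L_{g,\Xi}$-Lipschitz (uniformly in $x$). $G(x)=g(x,\cdot)\in\mathcal C(\Xi)$. $\mathcal M_+(\Xi)$: finite nonnegative Borel measures on $\Xi$; $\|\Lambda\|_{TV}=|\Lambda|(\Xi)$; $\langle\Lambda,h\rangle=\int_\Xi h\,d\Lambda$. Problem $\mathbb P$: $\inf\{f(x):x\in\mathcal X,\ g(x,\xi)\le0\ \forall\xi\in\Xi\}$; dual $\mathbb D$: $\sup_{\Lambda\in\mathcal M_+(\Xi)}\inf_{x\in\mathcal X}\{f(x)+\langle\Lambda,G(x)\rangle\}$ with value $\mathrm{val}(\mathbb D)$. It is assumed that $\mathbb P$ has an optimal solution and that some $\tilde x\in\mathcal X$ satisfies $g(\tilde x,\xi)<0$ for all $\xi$; $\alpha=\min_{\xi\in\Xi}\{-g(\tilde x,\xi)\}>0$. Fix $\theta>0$; $\bar\rho(\theta)=\frac1\alpha(f(\tilde x)-\mathrm{val}(\mathbb D))+\theta$; $\mathcal V=\{\Lambda\in\mathcal M_+(\Xi):\|\Lambda\|_{TV}\le\bar\rho(\theta)\}$.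 Fix $\rho_0\in(0,\bar\rho(\theta)]$; $\Lambda_u$ is the measure with constant Lebesgue density $\rho_0/\mathrm{vol}(\Xi)$ on $\Xi$. $B(\Lambda,\Gamma)=\int_\Xi\log\frac{d\Lambda}{d\Gamma}d\Lambda-\Lambda(\Xi)+\Gamma(\Xi)$ if $\Lambda\ll\Gamma$ and $\int|\log\frac{d\Lambda}{d\Gamma}|d\Lambda<\infty$, and $+\infty$ otherwise. Scheme: $x_0\in\mathcal X$, $\Lambda_0=\Lambda_u$; for $k\ge0$, $x_{k+1}=\arg\min_{x\in\mathcal X}[\gamma\langle x-x_k,\nabla f(x_k)+\mathcal G_k\rangle+\frac12\|x-x_k\|^2]$ for some vector $\mathcal G_k\in\mathbb R^m$ (an approximation of $\int_\Xi\nabla_xg(x_k,\xi)\Lambda_k(d\xi)$), and $\Lambda_{k+1}$ is a solution of the dual update problem displayed in the claim. $\Lambda_k(\xi)$ denotes the Lebesgue density of $\Lambda_k$ (a positive continuous function, starting with $\Lambda_0(\xi)=\rho_0/\mathrm{vol}(\Xi)$ and obtained inductively from the formula in the claim). *)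

theory Defs
  imports "HOL-Probability.Probability"
begin

definition nonneg_measures :: "(real^'d) set \<Rightarrow> (real^'d) measure set" where
  "nonneg_measures \<Xi> = {\<Lambda>. sets \<Lambda> = sets (restrict_space borel \<Xi>) \<and> finite_measure \<Lambda>}"

text \<open>The total variation norm, used only for nonnegative measures, where \<open>|\<Lambda>| = \<Lambda>\<close>.\<close>

definition tv_norm :: "'a measure \<Rightarrow> real" where
  "tv_norm \<Lambda> = measure \<Lambda> (space \<Lambda>)"

definition leb_density :: "(real^'d) set \<Rightarrow> (real^'d \<Rightarrow> real) \<Rightarrow> (real^'d) measure" where
  "leb_density \<Xi> p = density (restrict_space lborel \<Xi>) (\<lambda>\<xi>. ennreal (p \<xi>))"

definition uniform_density :: "(real^'d) set \<Rightarrow> real \<Rightarrow> real^'d \<Rightarrow> real" where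
  "uniform_density \<Xi> \<rho>0 = (\<lambda>\<xi>. \<rho>0 / measure lborel \<Xi>)"

text \<open>The argument order of the library notions is reversed: \<open>absolutely_continuous \<Gamma> \<Lambda>\<close>
  means \<open>\<Lambda> \<lless> \<Gamma>\<close>, and \<open>RN_deriv \<Gamma> \<Lambda>\<close> is \<open>d\<Lambda>/d\<Gamma>\<close>. Where this derivative vanishes, \<open>ln\<close> takes
  a junk value, but only on a \<open>\<Lambda>\<close>-null set.\<close>

definition log_RN :: "'a measure \<Rightarrow> 'a measure \<Rightarrow> 'a \<Rightarrow> real" where
  "log_RN \<Lambda> \<Gamma> \<xi> = ln (enn2real (RN_deriv \<Gamma> \<Lambda> \<xi>))"

definition bregman :: "'a measure \<Rightarrow> 'a measure \<Rightarrow> ereal" where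
  "bregman \<Lambda> \<Gamma> =
    (if absolutely_continuous \<Gamma> \<Lambda> \<and> integrable \<Lambda> (log_RN \<Lambda> \<Gamma>)
     then ereal ((\<integral>\<xi>. log_RN \<Lambda> \<Gamma> \<xi> \<partial>\<Lambda>) - measure \<Lambda> (space \<Lambda>) + measure \<Gamma> (space \<Gamma>))
     else \<infinity>)"

definition feasible :: "(real^'m) set \<Rightarrow> (real^'d) set \<Rightarrow> (real^'m \<Rightarrow> real^'d \<Rightarrow> real) \<Rightarrow> real^'m \<Rightarrow> bool" where
  "feasible X \<Xi> g x \<longleftrightarrow> x \<in> X \<and> (\<forall>\<xi>\<in>\<Xi>. g x \<xi> \<le> 0)"

definition dual_val ::
  "(real^'m) set \<Rightarrow> (real^'d) set \<Rightarrow> (real^'m \<Rightarrow> real) \<Rightarrow> (real^'m \<Rightarrow> real^'d \<Rightarrow> real) \<Rightarrow> ereal" where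
  "dual_val X \<Xi> f g =
    (SUP \<Lambda>\<in>nonneg_measures \<Xi>. INF x\<in>X. ereal (f x + (\<integral>\<xi>. g x \<xi> \<partial>\<Lambda>)))"

text \<open>For compact nonempty \<open>\<Xi>\<close> and continuous \<open>g xt\<close> this infimum is a minimum.\<close>

definition slater_margin :: "(real^'d) set \<Rightarrow> (real^'m \<Rightarrow> real^'d \<Rightarrow> real) \<Rightarrow> real^'m \<Rightarrow> real" where
  "slater_margin \<Xi> g xt = (INF \<xi>\<in>\<Xi>. - g xt \<xi>)"

text \<open>In the setting of interest \<open>dual_val\<close> is finite: it is bounded above by the optimal primal
  value, and below by the minimum of \<open>f\<close> (take \<open>\<Lambda> = 0\<close>).\<close>

definition rho_bar ::
  "(real^'m) set \<Rightarrow> (real^'d) set \<Rightarrow> (real^'m \<Rightarrow> real) \<Rightarrow> (real^'m \<Rightarrow> real^'d \<Rightarrow> real)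
    \<Rightarrow> real^'m \<Rightarrow> real \<Rightarrow> real" where
  "rho_bar X \<Xi> f g xt \<theta> =
    1 / slater_margin \<Xi> g xt * (f xt - real_of_ereal (dual_val X \<Xi> f g)) + \<theta>"

definition dual_ball :: "(real^'d) set \<Rightarrow> real \<Rightarrow> (real^'d) measure set" where
  "dual_ball \<Xi> r = {\<Lambda> \<in> nonneg_measures \<Xi>. tv_norm \<Lambda> \<le> r}"

definition primal_objective :: "real \<Rightarrow> real^'m \<Rightarrow> real^'m \<Rightarrow> real^'m \<Rightarrow> real" where
  "primal_objective \<gamma> xk v x = \<gamma> * ((x - xk) \<bullet> v) + 1/2 * (norm (x - xk))\<^sup>2"

text \<open>Here \<open>\<Lambda>u\<close> is the reference measure, \<open>\<Lambda>k\<close> the current dual iterate and \<open>h = G(x\<^sub>k)\<close>; the pairing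
  of the signed measure \<open>\<Lambda> - \<Lambda>k\<close> with \<open>-h\<close> is written out by linearity.\<close>

definition dual_objective ::
  "real \<Rightarrow> real \<Rightarrow> 'a measure \<Rightarrow> ('a \<Rightarrow> real) \<Rightarrow> 'a measure \<Rightarrow> 'a measure \<Rightarrow> ereal" where
  "dual_objective \<gamma> \<kappa> \<Lambda>u h \<Lambda>k \<Lambda> =
    ereal \<gamma> * (ereal ((\<integral>\<xi>. - h \<xi> \<partial>\<Lambda>) - (\<integral>\<xi>. - h \<xi> \<partial>\<Lambda>k)) + ereal \<kappa> * bregman \<Lambda> \<Lambda>u)
    + bregman \<Lambda> \<Lambda>k"

definition dual_update ::
  "(real^'d) set \<Rightarrow> real \<Rightarrow> real \<Rightarrow> real \<Rightarrow> real \<Rightarrow> (real^'d \<Rightarrow> real) \<Rightarrow> (real^'d \<Rightarrow> real)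
    \<Rightarrow> real^'d \<Rightarrow> real" where
  "dual_update \<Xi> \<gamma> \<kappa> \<rho> \<rho>0 h p \<xi> =
    min (\<rho> / ((\<rho>0 / measure lborel \<Xi>) powr (\<gamma> * \<kappa> / (1 + \<gamma> * \<kappa>)) *
              (LINT \<xi>':\<Xi>|lborel. exp (\<gamma> * h \<xi>' / (1 + \<gamma> * \<kappa>)) * p \<xi>' powr (1 / (1 + \<gamma> * \<kappa>))))) 1
    * (\<rho>0 / measure lborel \<Xi>) powr (\<gamma> * \<kappa> / (1 + \<gamma> * \<kappa>))
    * exp (\<gamma> * h \<xi> / (1 + \<gamma> * \<kappa>)) * p \<xi> powr (1 / (1 + \<gamma> * \<kappa>))"

primrec dual_density ::
  "(real^'d) set \<Rightarrow> (real^'m \<Rightarrow> real^'d \<Rightarrow> real) \<Rightarrow> real \<Rightarrow> real \<Rightarrow> real \<Rightarrow> real \<Rightarrow> (nat \<Rightarrow> real^'m)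
    \<Rightarrow> nat \<Rightarrow> real^'d \<Rightarrow> real" where
  "dual_density \<Xi> g \<gamma> \<kappa> \<rho> \<rho>0 x 0 = uniform_density \<Xi> \<rho>0"
| "dual_density \<Xi> g \<gamma> \<kappa> \<rho> \<rho>0 x (Suc k) =
    dual_update \<Xi> \<gamma> \<kappa> \<rho> \<rho>0 (g (x k)) (dual_density \<Xi> g \<gamma> \<kappa> \<rho> \<rho>0 x k)"

text \<open>Derivatives are taken relative to \<open>X\<close>, on which the functions are defined. If \<open>X\<close> is not
  full-dimensional the gradient is determined only up to a vector orthogonal to the directions
  of \<open>X\<close>.\<close>

definition gradient_on :: "('a::real_inner) set \<Rightarrow> ('a \<Rightarrow> real) \<Rightarrow> ('a \<Rightarrow> 'a) \<Rightarrow> bool" where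
  "gradient_on X f f' \<longleftrightarrow> (\<forall>x\<in>X. (f has_derivative (\<lambda>h. h \<bullet> f' x)) (at x within X))"

definition C1_on :: "('a::real_inner) set \<Rightarrow> ('a \<Rightarrow> real) \<Rightarrow> bool" where
  "C1_on X f \<longleftrightarrow> (\<exists>f'. gradient_on X f f' \<and> continuous_on X f')"

end

theory Submission
  imports Defs
begin

text \<open>Both entropy terms of the dual objective see a measure only through its Lebesgue density
  \<open>m\<close>: a measure without a density, or with \<open>m ln m\<close> not integrable, has infinite objective. On the
  remaining measures, let \<open>u\<close> be the density of the reference measure, \<open>p\<close> that of the current
  iterate and \<open>h = g x\<^sub>k\<close>. Every term of the objective is an integral of \<open>m ln m\<close>, of \<open>m\<close>, or of \<open>m\<close>
  times one of the bounded functions \<open>h\<close>, \<open>ln u\<close>, \<open>ln p\<close>. Collecting them gives, up to a constant,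
  \<open>1 + \<gamma> * \<kappa>\<close> times \<open>\<integral> m ln (m / v) - m\<close>, where \<open>v\<close> (called \<open>gibbs\<close> below) is determined by
  \<open>(1 + \<gamma> * \<kappa>) ln v = \<gamma> * \<kappa> * ln u + \<gamma> * h + ln p\<close>. So without the mass constraint the minimiser would
  be \<open>v\<close>.

  To treat the constraint \<open>\<integral> m \<le> \<rho>\<close>, put \<open>s = min (\<rho> / \<integral> v) 1\<close> and \<open>q = s * v\<close>. Replacing \<open>v\<close> by \<open>q\<close>
  shows that the objective is, again up to a constant and the factor \<open>1 + \<gamma> * \<kappa>\<close>,
  \<open>\<integral> (m ln (m / q) - m + q) + ln s * \<integral> m\<close>.
  The first integrand is nonnegative and vanishes only where \<open>m = q\<close>. The second term is minimised
  over the feasible masses at \<open>m = q\<close>, because either \<open>s = 1\<close> and the term is zero, or \<open>ln s < 0\<close> and \<open>q\<close>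
  has the largest allowed mass \<open>\<rho>\<close>: this is complementary slackness with multiplier \<open>- ln s\<close>.
  Hence \<open>q\<close> is the unique minimiser (\<open>entropic_step.is_arg_min_iff\<close>), and \<open>q\<close> is the function
  \<open>dual_update\<close>.

  The argument needs \<open>u\<close> and \<open>p\<close> positive with bounded logarithm, which holds for positive
  continuous functions on a compact set. The update is again positive and continuous, so the
  theorem follows for all iterates by induction, uniqueness identifying each iterate with the
  measure given by the formula.\<close>

section \<open>The pointwise entropy gap\<close>

text \<open>This is the Bregman divergence of \<open>t ln t - t\<close>, the integrand of the generalised
  Kullback-Leibler divergence between measures of unequal mass. At \<open>a = 0\<close> it takes the correct
  limit value \<open>b\<close> because \<open>0 * ln 0 = 0\<close>.\<close>

definition kl_gap :: "real \<Rightarrow> real \<Rightarrow> real" where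
  "kl_gap a b = a * ln (a / b) - a + b"

text \<open>The inequality is \<open>ln t \<le> t - 1\<close> at \<open>t = b / a\<close>, multiplied by \<open>a\<close>.\<close>

lemma kl_gap_nonneg:
  assumes "0 \<le> a" "0 < b"
  shows "0 \<le> kl_gap a b"
proof (cases "a = 0")
  case False
  with assms have a: "0 < a" by simp
  have "a * ln (b / a) \<le> a * (b / a - 1)"
    using a assms by (intro mult_left_mono ln_le_minus_one) auto
  moreover have "a * (b / a - 1) = b - a" using a by (simp add: field_simps)
  ultimately show ?thesis
    using a assms by (simp add: kl_gap_def ln_div algebra_simps)
qed (use assms in \<open>simp add: kl_gap_def\<close>)

text \<open>Strict convexity of the entropy enters here: \<open>ln t = t - 1\<close> only at \<open>t = 1\<close>. This is what
  makes the minimiser unique.\<close>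

lemma kl_gap_eq_0_iff:
  assumes "0 \<le> a" "0 < b"
  shows "kl_gap a b = 0 \<longleftrightarrow> a = b"
proof
  assume 0: "kl_gap a b = 0"
  with assms have "a \<noteq> 0" by (auto simp: kl_gap_def)
  with assms have a: "0 < a" by simp
  have "a * ln (b / a) = a * (b / a - 1)"
    using 0 a assms by (simp add: kl_gap_def ln_div algebra_simps)
  with a have "ln (b / a) = b / a - 1" by simp
  with a assms have "b / a = 1" by (intro ln_eq_minus_one) auto
  with a show "a = b" by (simp add: field_simps)
qed (use assms in \<open>simp add: kl_gap_def\<close>)

section \<open>Densities with bounded logarithm\<close>

text \<open>Bounding the logarithm bounds \<open>p\<close> away from both zero and infinity. Stated this way the
  property passes at once to products and powers, and \<open>m * ln p\<close> is integrable whenever \<open>m\<close> is.\<close>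

definition log_bounded :: "'a measure \<Rightarrow> ('a \<Rightarrow> real) \<Rightarrow> bool" where
  "log_bounded N p \<longleftrightarrow> p \<in> borel_measurable N \<and> (\<forall>x\<in>space N. 0 < p x)
    \<and> (\<exists>B. \<forall>x\<in>space N. \<bar>ln (p x)\<bar> \<le> B)"

lemma log_boundedD:
  assumes "log_bounded N p"
  shows "p \<in> borel_measurable N" "x \<in> space N \<Longrightarrow> 0 < p x"
  using assms by (auto simp: log_bounded_def)

lemma integrable_log_bounded:
  assumes "finite_measure N" "log_bounded N p"
  shows "integrable N p"
proof -
  interpret finite_measure N by fact
  from assms(2) obtain B where B: "\<And>x. x \<in> space N \<Longrightarrow> \<bar>ln (p x)\<bar> \<le> B"
    by (auto simp: log_bounded_def)
  have "\<bar>p x\<bar> \<le> exp B" if "x \<in> space N" for x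
  proof -
    have "exp (ln (p x)) \<le> exp B" using B[OF that] by simp
    then show ?thesis using log_boundedD(2)[OF assms(2) that] by simp
  qed
  then show ?thesis
    using log_boundedD(1)[OF assms(2)] by (intro integrable_const_bound[of _ "exp B"]) auto
qed

lemma integrable_bounded_mult:
  fixes m b :: "'a \<Rightarrow> real"
  assumes "integrable N m" "b \<in> borel_measurable N" "\<exists>B. \<forall>x\<in>space N. \<bar>b x\<bar> \<le> B"
  shows "integrable N (\<lambda>x. m x * b x)"
proof -
  from assms(3) obtain B where B: "\<And>x. x \<in> space N \<Longrightarrow> \<bar>b x\<bar> \<le> B" by auto
  have meas: "(\<lambda>x. m x * b x) \<in> borel_measurable N"
    using borel_measurable_integrable[OF assms(1)] assms(2) by measurable
  have *: "norm (m x * b x) \<le> norm (\<bar>m x\<bar> * B)" if "x \<in> space N" for x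
  proof -
    have "0 \<le> B" using B[OF that] by (meson abs_ge_zero order_trans)
    then show ?thesis using B[OF that] by (simp add: abs_mult mult_left_mono)
  qed
  show ?thesis
    by (rule Bochner_Integration.integrable_bound[OF _ meas AE_I2[OF *]])
       (use assms(1) in auto)
qed

lemma xlnx_div:
  fixes a b :: real
  assumes "0 \<le> a" "0 < b"
  shows "a * ln (a / b) = a * ln a - a * ln b"
  using assms by (cases "a = 0") (auto simp: ln_div algebra_simps)

lemma integrable_kl_gap:
  assumes "finite_measure N" "log_bounded N p" "integrable N m" "\<And>x. 0 \<le> m x"
    "integrable N (\<lambda>x. m x * ln (m x))"
  shows "integrable N (\<lambda>x. kl_gap (m x) (p x))"
proof -
  note [measurable] = log_boundedD(1)[OF assms(2)] borel_measurable_integrable[OF assms(3)]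
  have "integrable N (\<lambda>x. m x * ln (m x) - m x * ln (p x) - m x + p x)"
    using assms integrable_log_bounded[OF assms(1,2)]
    by (intro Bochner_Integration.integrable_add Bochner_Integration.integrable_diff
          integrable_bounded_mult[where b="\<lambda>x. ln (p x)"]) (auto simp: log_bounded_def)
  then show ?thesis
    by (rule Bochner_Integration.integrable_cong[OF refl, THEN iffD1, rotated])
       (use assms(4) log_boundedD(2)[OF assms(2)] in \<open>simp add: kl_gap_def xlnx_div\<close>)
qed

section \<open>The divergence of measures with densities\<close>

lemma measure_density_space:
  fixes m :: "'a \<Rightarrow> real"
  assumes "m \<in> borel_measurable N" "\<And>x. x \<in> space N \<Longrightarrow> 0 \<le> m x"
  shows "measure (density N m) (space N) = (\<integral>x. m x \<partial>N)"
  using integral_density[of "\<lambda>_. 1::real" N m] assms by simp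

lemma finite_measure_density_iff:
  fixes m :: "'a \<Rightarrow> real"
  assumes [measurable]: "m \<in> borel_measurable N" and nn: "\<And>x. x \<in> space N \<Longrightarrow> 0 \<le> m x"
  shows "finite_measure (density N m) \<longleftrightarrow> integrable N m"
proof -
  have "emeasure (density N m) (space N) = (\<integral>\<^sup>+x. ennreal (m x) \<partial>N)"
    by (subst emeasure_density) (auto intro!: nn_integral_cong)
  also have "\<dots> = (\<integral>\<^sup>+x. ennreal (norm (m x)) \<partial>N)"
    using nn by (intro nn_integral_cong) auto
  finally show ?thesis
    by (auto simp: integrable_iff_bounded less_top intro!: finite_measureI
        dest: finite_measure.emeasure_finite[of _ "space N"])
qed

text \<open>The measure with density \<open>m\<close> has density \<open>m / p\<close> with respect to the one with density
  \<open>p\<close>, so the claim is uniqueness of the Radon-Nikodym derivative. That holds almost everywhere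
  for the second measure, hence for \<open>N\<close> because \<open>p\<close> is positive, hence for the first.\<close>

lemma log_RN_density:
  assumes "finite_measure N" "log_bounded N p" "m \<in> borel_measurable N" "\<And>x. 0 \<le> m x"
  shows "AE x in density N m. log_RN (density N m) (density N p) x = ln (m x / p x)"
proof -
  interpret finite_measure N by fact
  note [measurable] = log_boundedD(1)[OF assms(2)] assms(3)
  note pos = log_boundedD(2)[OF assms(2)]
  interpret P: finite_measure "density N p"
    using integrable_log_bounded[OF assms(1,2)] pos
    by (subst finite_measure_density_iff) (auto simp: less_imp_le)
  have "density (density N p) (\<lambda>x. ennreal (m x / p x)) = density N (\<lambda>x. ennreal (p x) * ennreal (m x / p x))"
    by (rule density_density_eq) auto
  also have "\<dots> = density N m"
    by (rule density_cong)
       (use pos assms(4) in \<open>auto simp: ennreal_mult''[symmetric] less_imp_le intro!: AE_I2\<close>, metis less_irrefl)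
  finally have "AE x in density N p. ennreal (m x / p x) = RN_deriv (density N p) (density N m) x"
    by (intro P.RN_deriv_unique) auto
  then have "AE x in N. ennreal (m x / p x) = RN_deriv (density N p) (density N m) x"
    by (subst (asm) AE_density) (use pos in \<open>auto elim!: eventually_mono\<close>)
  then have "AE x in N. log_RN (density N m) (density N p) x = ln (m x / p x)"
    using AE_space
  proof eventually_elim
    case (elim x)
    have "0 \<le> m x / p x" using pos[OF elim(2)] assms(4)[of x] by simp
    then show ?case by (simp add: log_RN_def flip: elim(1))
  qed
  then show ?thesis by (subst AE_density) auto
qed

text \<open>Since \<open>ln p\<close> is bounded, finiteness of the divergence depends on \<open>m\<close> only, so the two
  divergences in the dual objective are finite for the same measures.\<close>

lemma bregman_density:
  assumes "finite_measure N" "log_bounded N p" "integrable N m" "\<And>x. 0 \<le> m x"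
  shows "bregman (density N m) (density N p) =
    (if integrable N (\<lambda>x. m x * ln (m x)) then ereal (\<integral>x. kl_gap (m x) (p x) \<partial>N) else \<infinity>)"
proof -
  note [measurable] = log_boundedD(1)[OF assms(2)] borel_measurable_integrable[OF assms(3)]
  note pos = log_boundedD(2)[OF assms(2)]
  let ?M = "density N m" and ?P = "density N p"
  have ac: "absolutely_continuous ?P ?M"
  proof -
    have "A \<in> null_sets ?M" if "A \<in> null_sets ?P" for A
    proof -
      from that have A: "A \<in> sets N" "AE x in N. x \<in> A \<longrightarrow> ennreal (p x) = 0"
        by (auto simp: null_sets_density_iff)
      from A(2) AE_space have "AE x in N. x \<in> A \<longrightarrow> ennreal (m x) = 0"
      proof eventually_elim
        case (elim x)
        then show ?case using pos[of x] by auto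
      qed
      with A(1) show ?thesis by (auto simp: null_sets_density_iff)
    qed
    then show ?thesis by (auto simp: absolutely_continuous_def)
  qed
  have log: "AE x in ?M. log_RN ?M ?P x = ln (m x / p x)"
    using assms by (intro log_RN_density) auto
  have meas [measurable]: "log_RN ?M ?P \<in> borel_measurable N"
    using borel_measurable_RN_deriv[of ?P ?M] by (simp add: log_RN_def[abs_def])
  have split: "m x * ln (m x / p x) = m x * ln (m x) - m x * ln (p x)" if "x \<in> space N" for x
    using pos[OF that] assms(4) by (simp add: xlnx_div)
  have mlp: "integrable N (\<lambda>x. m x * ln (p x))"
    using assms by (intro integrable_bounded_mult[where b="\<lambda>x. ln (p x)"]) (auto simp: log_bounded_def)
  have int_split: "integrable N (\<lambda>x. m x * ln (m x / p x))
      \<longleftrightarrow> integrable N (\<lambda>x. m x * ln (m x) - m x * ln (p x))"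
    using split by (intro Bochner_Integration.integrable_cong) auto
  have "integrable ?M (log_RN ?M ?P) \<longleftrightarrow> integrable ?M (\<lambda>x. ln (m x / p x))"
    using log by (intro integrable_cong_AE) auto
  also have "\<dots> \<longleftrightarrow> integrable N (\<lambda>x. m x * ln (m x / p x))"
    using assms(4) by (subst integrable_density) auto
  also note int_split
  also have "integrable N (\<lambda>x. m x * ln (m x) - m x * ln (p x))
      \<longleftrightarrow> integrable N (\<lambda>x. m x * ln (m x))"
  proof
    assume "integrable N (\<lambda>x. m x * ln (m x) - m x * ln (p x))"
    from Bochner_Integration.integrable_add[OF this mlp]
    show "integrable N (\<lambda>x. m x * ln (m x))" by simp
  next
    assume "integrable N (\<lambda>x. m x * ln (m x))"
    then show "integrable N (\<lambda>x. m x * ln (m x) - m x * ln (p x))"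
      using mlp by (rule Bochner_Integration.integrable_diff)
  qed
  finally have int_iff: "integrable ?M (log_RN ?M ?P) \<longleftrightarrow> integrable N (\<lambda>x. m x * ln (m x))" .
  show ?thesis
  proof (cases "integrable N (\<lambda>x. m x * ln (m x))")
    case True
    have int1: "integrable N (\<lambda>x. m x * ln (m x / p x))"
      unfolding int_split using True mlp by (rule Bochner_Integration.integrable_diff)
    have "(\<integral>x. log_RN ?M ?P x \<partial>?M) = (\<integral>x. ln (m x / p x) \<partial>?M)"
      using log by (intro integral_cong_AE) auto
    also have "\<dots> = (\<integral>x. m x * ln (m x / p x) \<partial>N)"
      using assms(4) by (subst integral_density) auto
    finally have "(\<integral>x. log_RN ?M ?P x \<partial>?M) - measure ?M (space ?M) + measure ?P (space ?P)
        = (\<integral>x. m x * ln (m x / p x) \<partial>N) - (\<integral>x. m x \<partial>N) + (\<integral>x. p x \<partial>N)"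
      using pos assms(4) by (simp add: measure_density_space less_imp_le)
    also have "\<dots> = (\<integral>x. kl_gap (m x) (p x) \<partial>N)"
      using int1 assms(3) integrable_log_bounded[OF assms(1,2)] by (simp add: kl_gap_def)
    finally show ?thesis
      using True ac int_iff by (simp add: bregman_def)
  qed (simp add: bregman_def int_iff)
qed

text \<open>Radon-Nikodym with a real-valued derivative. Null sets of \<open>N\<close> are null for the measure
  with density \<open>p\<close>, so absolute continuity with respect to the latter gives it with respect to \<open>N\<close>.\<close>

lemma absolutely_continuous_density_obtain:
  fixes p :: "'a \<Rightarrow> real"
  assumes "finite_measure N" "p \<in> borel_measurable N"
    and M: "sets M = sets N" "finite_measure M" "absolutely_continuous (density N p) M"
  obtains m :: "'a \<Rightarrow> real" where "integrable N m" "\<And>x. 0 \<le> m x" "M = density N m"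
proof -
  interpret N: finite_measure N by fact
  note [measurable] = assms(2)
  have ac: "absolutely_continuous N M"
    using M(3) absolutely_continuousI_density[of "\<lambda>x. ennreal (p x)" N] assms(2)
    by (auto simp: absolutely_continuous_def)
  obtain m where m: "m \<in> borel_measurable N" "AE x in N. RN_deriv N M x = ennreal (m x)"
      "\<And>x. 0 \<le> m x"
    using N.real_RN_deriv[OF M(2) ac M(1)] by metis
  have "M = density N (RN_deriv N M)"
    using N.density_RN_deriv[OF ac M(1)] by simp
  also have "\<dots> = density N m"
    using m by (intro density_cong) auto
  finally have eq: "M = density N m" .
  have "integrable N m"
    using M(2) m finite_measure_density_iff[of m N] by (simp add: eq)
  with m eq that show thesis by blast
qed

section \<open>One entropic step under a mass bound\<close>

text \<open>\<open>N\<close> is the base measure, \<open>u\<close> the density of the reference measure of the regulariser, \<open>p\<close>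
  that of the current iterate and \<open>h\<close> the ascent direction; \<open>\<rho>\<close> is the bound on the mass.\<close>

locale entropic_step = finite_measure N
  for N :: "'a measure" +
  fixes \<gamma> \<kappa> \<rho> :: real and u p h :: "'a \<Rightarrow> real"
  assumes pos: "0 < \<gamma>" "0 < \<kappa>" "0 < \<rho>"
    and nontrivial: "measure N (space N) \<noteq> 0"
    and u: "log_bounded N u" and p: "log_bounded N p"
    and h: "h \<in> borel_measurable N" "\<exists>B. \<forall>x\<in>space N. \<bar>h x\<bar> \<le> B"
begin

text \<open>The minimiser of the objective when the mass is not constrained.\<close>

definition gibbs :: "'a \<Rightarrow> real" where
  "gibbs x = u x powr (\<gamma> * \<kappa> / (1 + \<gamma> * \<kappa>)) * exp (\<gamma> * h x / (1 + \<gamma> * \<kappa>))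
    * p x powr (1 / (1 + \<gamma> * \<kappa>))"

definition scaling :: real where
  "scaling = min (\<rho> / (\<integral>x. gibbs x \<partial>N)) 1"

definition minimizer :: "'a \<Rightarrow> real" where
  "minimizer x = scaling * gibbs x"

lemma gk_pos: "0 < 1 + \<gamma> * \<kappa>"
  using pos by (simp add: add_pos_pos)

text \<open>The first-order optimality condition of the unconstrained problem.\<close>

lemma ln_gibbs:
  assumes "x \<in> space N"
  shows "(1 + \<gamma> * \<kappa>) * ln (gibbs x) = \<gamma> * \<kappa> * ln (u x) + \<gamma> * h x + ln (p x)"
proof -
  define c where "c = 1 + \<gamma> * \<kappa>"
  have "ln (gibbs x) = \<gamma> * \<kappa> / c * ln (u x) + \<gamma> * h x / c + 1 / c * ln (p x)"
    using log_boundedD(2)[OF u assms] log_boundedD(2)[OF p assms]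
    by (simp add: gibbs_def ln_mult c_def)
  moreover have "c \<noteq> 0" using gk_pos by (simp add: c_def)
  ultimately show ?thesis by (simp add: distrib_left flip: c_def)
qed

lemma log_bounded_gibbs: "log_bounded N gibbs"
proof -
  note [measurable] = log_boundedD(1)[OF u] log_boundedD(1)[OF p] h(1)
  from u p h(2) obtain Bu Bp Bh where
    B: "\<And>x. x \<in> space N \<Longrightarrow> \<bar>ln (u x)\<bar> \<le> Bu" "\<And>x. x \<in> space N \<Longrightarrow> \<bar>ln (p x)\<bar> \<le> Bp"
       "\<And>x. x \<in> space N \<Longrightarrow> \<bar>h x\<bar> \<le> Bh"
    unfolding log_bounded_def by metis
  have "\<bar>ln (gibbs x)\<bar> \<le> (\<gamma> * \<kappa> * Bu + \<gamma> * Bh + Bp) / (1 + \<gamma> * \<kappa>)" if x: "x \<in> space N" for x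
  proof -
    have "(1 + \<gamma> * \<kappa>) * \<bar>ln (gibbs x)\<bar> = \<bar>\<gamma> * \<kappa> * ln (u x) + \<gamma> * h x + ln (p x)\<bar>"
      using gk_pos by (simp flip: ln_gibbs[OF x] add: abs_mult)
    also have "\<dots> \<le> \<bar>\<gamma> * \<kappa> * ln (u x)\<bar> + \<bar>\<gamma> * h x\<bar> + \<bar>ln (p x)\<bar>" by linarith
    also have "\<dots> \<le> \<gamma> * \<kappa> * Bu + \<gamma> * Bh + Bp"
      using B[OF x] pos by (intro add_mono) (auto simp: abs_mult intro!: mult_left_mono)
    finally show ?thesis using gk_pos by (simp add: pos_le_divide_eq mult.commute)
  qed
  moreover have "gibbs \<in> borel_measurable N" unfolding gibbs_def[abs_def] by measurable
  moreover have "\<forall>x\<in>space N. 0 < gibbs x"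
    using log_boundedD(2)[OF u] log_boundedD(2)[OF p] by (fastforce simp: gibbs_def)
  ultimately show ?thesis by (auto simp: log_bounded_def)
qed

lemma integral_gibbs_pos: "0 < (\<integral>x. gibbs x \<partial>N)"
proof -
  note gibbs_pos = log_boundedD(2)[OF log_bounded_gibbs]
  have int: "integrable N gibbs"
    by (rule integrable_log_bounded[OF finite_measure_axioms log_bounded_gibbs])
  have "(\<integral>x. gibbs x \<partial>N) \<noteq> 0"
  proof
    assume "(\<integral>x. gibbs x \<partial>N) = 0"
    then have "AE x in N. gibbs x = 0"
      using int gibbs_pos by (subst (asm) integral_nonneg_eq_0_iff_AE) (auto simp: less_imp_le)
    with AE_space have "AE x in N. False"
      by eventually_elim (use gibbs_pos in force)
    then have "emeasure N (space N) = 0" by (simp add: AE_iff_null_sets null_setsD1 eventually_ae_filter)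
    with nontrivial show False by (simp add: measure_def)
  qed
  moreover have "0 \<le> (\<integral>x. gibbs x \<partial>N)"
    using gibbs_pos by (intro integral_nonneg_AE AE_I2) (auto simp: less_imp_le)
  ultimately show ?thesis by simp
qed

lemma scaling_bounds: "0 < scaling" "scaling \<le> 1"
  using integral_gibbs_pos pos by (auto simp: scaling_def)

lemma log_bounded_minimizer: "log_bounded N minimizer"
proof -
  from log_bounded_gibbs obtain B where B: "\<And>x. x \<in> space N \<Longrightarrow> \<bar>ln (gibbs x)\<bar> \<le> B"
    by (auto simp: log_bounded_def)
  have "\<bar>ln (minimizer x)\<bar> \<le> \<bar>ln scaling\<bar> + B" if "x \<in> space N" for x
  proof -
    have "ln (minimizer x) = ln scaling + ln (gibbs x)"
      using scaling_bounds log_boundedD(2)[OF log_bounded_gibbs that]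
      by (simp add: minimizer_def ln_mult)
    with B[OF that] show ?thesis by linarith
  qed
  then show ?thesis
    using log_bounded_gibbs scaling_bounds unfolding log_bounded_def minimizer_def[abs_def] by auto
qed

lemma minimizer_nonneg: "0 \<le> minimizer x"
  using scaling_bounds by (simp add: minimizer_def gibbs_def)

lemma integral_minimizer:
  "(\<integral>x. minimizer x \<partial>N) = scaling * (\<integral>x. gibbs x \<partial>N)"
  by (simp add: minimizer_def)

lemma integral_minimizer_le: "(\<integral>x. minimizer x \<partial>N) \<le> \<rho>"
  using integral_gibbs_pos by (simp add: integral_minimizer scaling_def min_def field_simps)

text \<open>Complementary slackness: if the bound is not attained by the minimiser then
  \<open>scaling = 1\<close> and both sides vanish; otherwise \<open>ln scaling \<le> 0\<close> and the minimiser has the largest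
  admissible mass.\<close>

lemma scaling_slack:
  assumes "a \<le> \<rho>"
  shows "ln scaling * (\<integral>x. minimizer x \<partial>N) \<le> ln scaling * a"
proof (cases "scaling = 1")
  case False
  then have "(\<integral>x. minimizer x \<partial>N) = \<rho>"
    using integral_gibbs_pos by (auto simp: integral_minimizer scaling_def min_def split: if_splits)
  moreover have "ln scaling \<le> 0" using scaling_bounds by simp
  ultimately show ?thesis using assms by (simp add: mult_left_mono_neg)
qed simp

text \<open>The part of the objective that does not depend on the competing density.\<close>

definition offset :: real where
  "offset = (\<integral>x. \<gamma> * \<kappa> * u x + p x + \<gamma> * (p x * h x) - (1 + \<gamma> * \<kappa>) * minimizer x \<partial>N)"

text \<open>Completing the divergence: after expanding the logarithms, \<open>a * ln a\<close> has coefficient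
  \<open>1 + \<gamma> * \<kappa>\<close> on both sides, and the terms \<open>a * h\<close>, \<open>a * ln u\<close> and \<open>a * ln p\<close> combine into
  \<open>a * ln gibbs\<close> by \<open>ln_gibbs\<close>.\<close>

lemma objective_pointwise:
  assumes "x \<in> space N" "0 \<le> a"
  shows "\<gamma> * (p x * h x - a * h x) + \<gamma> * \<kappa> * kl_gap a (u x) + kl_gap a (p x)
    = (1 + \<gamma> * \<kappa>) * (kl_gap a (minimizer x) + ln scaling * a)
      + (\<gamma> * \<kappa> * u x + p x + \<gamma> * (p x * h x) - (1 + \<gamma> * \<kappa>) * minimizer x)"
proof -
  note P = log_boundedD(2)[OF u assms(1)] log_boundedD(2)[OF p assms(1)]
    log_boundedD(2)[OF log_bounded_minimizer assms(1)] log_boundedD(2)[OF log_bounded_gibbs assms(1)]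
  have "(1 + \<gamma> * \<kappa>) * ln (minimizer x)
      = (1 + \<gamma> * \<kappa>) * ln scaling + (\<gamma> * \<kappa> * ln (u x) + \<gamma> * h x + ln (p x))"
    using P scaling_bounds by (simp add: minimizer_def ln_mult distrib_left ln_gibbs[OF assms(1)])
  then have "a * ((1 + \<gamma> * \<kappa>) * ln (minimizer x))
      = a * ((1 + \<gamma> * \<kappa>) * ln scaling + (\<gamma> * \<kappa> * ln (u x) + \<gamma> * h x + ln (p x)))" by simp
  then show ?thesis
    using P assms(2) by (simp add: kl_gap_def xlnx_div algebra_simps)
qed

lemma dual_objective_density:
  assumes m: "integrable N m" "\<And>x. 0 \<le> m x" "integrable N (\<lambda>x. m x * ln (m x))"
  shows "dual_objective \<gamma> \<kappa> (density N u) h (density N p) (density N m) =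
    ereal (offset + (1 + \<gamma> * \<kappa>) *
      ((\<integral>x. kl_gap (m x) (minimizer x) \<partial>N) + ln scaling * (\<integral>x. m x \<partial>N)))"
proof -
  note fin = finite_measure_axioms
  note [measurable] = log_boundedD(1)[OF u] log_boundedD(1)[OF p] h(1) borel_measurable_integrable[OF m(1)]
  note [simp] = integrable_log_bounded[OF fin u] integrable_log_bounded[OF fin p]
    integrable_log_bounded[OF fin log_bounded_minimizer] m(1)
    integrable_kl_gap[OF fin u m] integrable_kl_gap[OF fin p m]
    integrable_kl_gap[OF fin log_bounded_minimizer m]
    integrable_bounded_mult[OF m(1) h] integrable_bounded_mult[OF _ h, of p]
  have hm: "(\<integral>x. h x \<partial>density N m) = (\<integral>x. m x * h x \<partial>N)"
    using m(2) by (subst integral_density) auto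
  have hp: "(\<integral>x. h x \<partial>density N p) = (\<integral>x. p x * h x \<partial>N)"
    using log_boundedD(2)[OF p] by (subst integral_density) (auto simp: less_imp_le)
  have "dual_objective \<gamma> \<kappa> (density N u) h (density N p) (density N m) =
     ereal (\<gamma> * (- (\<integral>x. m x * h x \<partial>N) + (\<integral>x. p x * h x \<partial>N)
        + \<kappa> * (\<integral>x. kl_gap (m x) (u x) \<partial>N)) + (\<integral>x. kl_gap (m x) (p x) \<partial>N))"
    using m by (simp add: dual_objective_def hm hp bregman_density[OF fin u m(1,2)]
        bregman_density[OF fin p m(1,2)])
  also have "\<gamma> * (- (\<integral>x. m x * h x \<partial>N) + (\<integral>x. p x * h x \<partial>N)
        + \<kappa> * (\<integral>x. kl_gap (m x) (u x) \<partial>N)) + (\<integral>x. kl_gap (m x) (p x) \<partial>N)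
      = (\<integral>x. \<gamma> * (p x * h x - m x * h x) + \<gamma> * \<kappa> * kl_gap (m x) (u x) + kl_gap (m x) (p x) \<partial>N)"
    by (simp add: distrib_left right_diff_distrib mult.assoc)
  also have "\<dots> = (\<integral>x. (1 + \<gamma> * \<kappa>) * (kl_gap (m x) (minimizer x) + ln scaling * m x)
      + (\<gamma> * \<kappa> * u x + p x + \<gamma> * (p x * h x) - (1 + \<gamma> * \<kappa>) * minimizer x) \<partial>N)"
    using objective_pointwise m(2) by (intro Bochner_Integration.integral_cong) auto
  also have "\<dots> = offset + (1 + \<gamma> * \<kappa>) *
      ((\<integral>x. kl_gap (m x) (minimizer x) \<partial>N) + ln scaling * (\<integral>x. m x \<partial>N))"
    unfolding offset_def by (subst Bochner_Integration.integral_add) simp_all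
  finally show ?thesis .
qed

text \<open>A finite objective forces the divergence from the current iterate to be finite, because
  the remaining terms never equal \<open>- \<infinity>\<close>. So such a measure has a density of finite entropy.\<close>

lemma finite_objective_obtain:
  assumes M: "sets M = sets N" "finite_measure M"
    and finite: "dual_objective \<gamma> \<kappa> (density N u) h (density N p) M \<noteq> \<infinity>"
  obtains m where "integrable N m" "\<And>x. 0 \<le> m x" "integrable N (\<lambda>x. m x * ln (m x))"
    "M = density N m"
proof -
  have B: "bregman M (density N p) \<noteq> \<infinity>"
    using finite by (auto simp: dual_objective_def)
  then have "absolutely_continuous (density N p) M"
    by (auto simp: bregman_def split: if_splits)
  then obtain m where m: "integrable N m" "\<And>x. 0 \<le> m x" "M = density N m"
    using absolutely_continuous_density_obtain[OF finite_measure_axioms log_boundedD(1)[OF p] M] by metis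
  with B that show thesis
    by (auto simp: bregman_density[OF finite_measure_axioms p] split: if_splits)
qed

theorem is_arg_min_iff:
  "is_arg_min (dual_objective \<gamma> \<kappa> (density N u) h (density N p))
      (\<lambda>M. sets M = sets N \<and> finite_measure M \<and> measure M (space M) \<le> \<rho>) M
    \<longleftrightarrow> M = density N minimizer" (is "is_arg_min ?J ?F M \<longleftrightarrow> M = ?Q")
proof -
  note fin = finite_measure_axioms
  note minimizer_pos = log_boundedD(2)[OF log_bounded_minimizer]
  note int_min = integrable_log_bounded[OF fin log_bounded_minimizer]
  note [measurable] = borel_measurable_integrable[OF int_min]
  have min_ln: "integrable N (\<lambda>x. minimizer x * ln (minimizer x))"
    using int_min log_bounded_minimizer
    by (intro integrable_bounded_mult[where b="\<lambda>x. ln (minimizer x)"]) (auto simp: log_bounded_def)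
  have gap_Q: "(\<integral>x. kl_gap (minimizer x) (minimizer x) \<partial>N) = 0"
    using minimizer_pos kl_gap_eq_0_iff minimizer_nonneg
    by (subst Bochner_Integration.integral_cong[of N N _ "\<lambda>_. 0"]) auto
  have J_Q: "?J ?Q = ereal (offset + (1 + \<gamma> * \<kappa>) * (ln scaling * (\<integral>x. minimizer x \<partial>N)))"
    using dual_objective_density[OF int_min minimizer_nonneg min_ln] by (simp add: gap_Q)
  have F_Q: "?F ?Q"
    using integral_minimizer_le int_min minimizer_nonneg
    by (simp add: measure_density_space finite_measure_density_iff)
  \<comment> \<open>A feasible competitor is strictly worse: it has either infinite objective or a density that
      differs from the minimiser on a set of positive measure, and then a positive integrated gap.\<close>
  have key: "?J ?Q < ?J M" if F: "?F M" and ne: "M \<noteq> ?Q" for M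
  proof (cases "?J M = \<infinity>")
    case False
    then obtain m where m: "integrable N m" "\<And>x. 0 \<le> m x" "integrable N (\<lambda>x. m x * ln (m x))"
      and M: "M = density N m"
      using finite_objective_obtain F by metis
    note [measurable] = borel_measurable_integrable[OF m(1)]
    have gap_nn: "0 \<le> kl_gap (m x) (minimizer x)" if "x \<in> space N" for x
      using kl_gap_nonneg m(2) minimizer_pos[OF that] by simp
    note int_gap = integrable_kl_gap[OF fin log_bounded_minimizer m]
    have "(\<integral>x. kl_gap (m x) (minimizer x) \<partial>N) \<noteq> 0"
    proof
      assume "(\<integral>x. kl_gap (m x) (minimizer x) \<partial>N) = 0"
      then have "AE x in N. kl_gap (m x) (minimizer x) = 0"
        using int_gap gap_nn by (subst (asm) integral_nonneg_eq_0_iff_AE) auto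
      with AE_space have "AE x in N. ennreal (m x) = ennreal (minimizer x)"
        by eventually_elim (use kl_gap_eq_0_iff m(2) minimizer_pos in simp)
      then have "M = ?Q" unfolding M by (intro density_cong) auto
      with ne show False by simp
    qed
    moreover have "0 \<le> (\<integral>x. kl_gap (m x) (minimizer x) \<partial>N)"
      using gap_nn by (intro integral_nonneg_AE AE_I2)
    moreover have "(\<integral>x. m x \<partial>N) \<le> \<rho>"
      using F m(2) by (simp add: M measure_density_space)
    note scaling_slack[OF this]
    ultimately have "ln scaling * (\<integral>x. minimizer x \<partial>N)
        < (\<integral>x. kl_gap (m x) (minimizer x) \<partial>N) + ln scaling * (\<integral>x. m x \<partial>N)" by linarith
    then show ?thesis
      using gk_pos unfolding J_Q M dual_objective_density[OF m] by simp
  next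
    case True
    then show ?thesis unfolding J_Q by simp
  qed
  show ?thesis
  proof
    assume "is_arg_min ?J ?F M"
    then show "M = ?Q"
      using key[of M] F_Q by (fastforce simp: is_arg_min_def)
  next
    have "\<not> ?J M' < ?J ?Q" if "?F M'" for M'
      using key[OF that] by (cases "M' = ?Q") (auto dest: less_asym)
    moreover assume "M = ?Q"
    ultimately show "is_arg_min ?J ?F M"
      using F_Q unfolding is_arg_min_def by blast
  qed
qed

end


section \<open>The dual update on a compact set\<close>

text \<open>A full-dimensional convex set has interior points, and a convex set is Lebesgue-null only
  if its interior is empty.\<close>

lemma convex_full_dim_measure_pos:
  fixes S :: "'a::euclidean_space set"
  assumes "compact S" "convex S" "aff_dim S = int DIM('a)"
  shows "0 < measure lborel S"
proof -
  have "S \<noteq> {}" using assms(3) by auto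
  then have "interior S \<noteq> {}"
    using rel_interior_eq_empty[OF assms(2)] interior_rel_interior[OF assms(3)] by simp
  then have "\<not> negligible S" using negligible_convex_interior[OF assms(2)] by simp
  then have "measure lebesgue S \<noteq> 0"
    using negligible_iff_measure lmeasurable_compact[OF assms(1)] by blast
  moreover have "measure lebesgue S = measure lborel S"
    using assms(1) by (simp add: measure_completion borel_compact)
  ultimately show ?thesis by (simp add: zero_less_measure_iff)
qed

lemma borel_measurable_continuous_restrict_lborel:
  fixes p :: "'a::euclidean_space \<Rightarrow> real"
  assumes "continuous_on S p"
  shows "p \<in> borel_measurable (restrict_space lborel S)"
  using borel_measurable_continuous_on_restrict[OF assms]
  by (simp cong: measurable_cong_sets sets_restrict_space_cong)

lemma bounded_continuous_compact:
  fixes p :: "'a::topological_space \<Rightarrow> real"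
  assumes "compact S" "continuous_on S p"
  shows "\<exists>B. \<forall>x\<in>S. \<bar>p x\<bar> \<le> B"
  using compact_imp_bounded[OF compact_continuous_image[OF assms(2,1)]]
  by (auto simp: bounded_iff)

lemma log_bounded_continuous:
  fixes p :: "'a::euclidean_space \<Rightarrow> real"
  assumes "compact S" "continuous_on S p" "\<And>x. x \<in> S \<Longrightarrow> 0 < p x"
  shows "log_bounded (restrict_space lborel S) p"
proof -
  have "continuous_on S (\<lambda>x. ln (p x))"
    using assms by (intro continuous_intros) force+
  then show ?thesis
    using assms bounded_continuous_compact[OF assms(1), of "\<lambda>x. ln (p x)"]
    by (simp add: log_bounded_def space_restrict_space borel_measurable_continuous_restrict_lborel)
qed

text \<open>The abstract step for Lebesgue measure on \<open>\<Xi>\<close> with constant reference density. The first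
  two claims reproduce the hypotheses on \<open>p\<close>, so the step can be iterated.\<close>

lemma dual_update_characterisation:
  fixes \<Xi> :: "(real^'d) set"
  assumes \<Xi>: "compact \<Xi>" "0 < measure lborel \<Xi>"
    and params: "0 < \<gamma>" "0 < \<kappa>" "0 < \<rho>" "0 < \<rho>0"
    and h_cont: "continuous_on \<Xi> h"
    and p_cont: "continuous_on \<Xi> p" "\<And>\<xi>. \<xi> \<in> \<Xi> \<Longrightarrow> 0 < p \<xi>"
  shows "continuous_on \<Xi> (dual_update \<Xi> \<gamma> \<kappa> \<rho> \<rho>0 h p)"
    and "\<xi> \<in> \<Xi> \<Longrightarrow> 0 < dual_update \<Xi> \<gamma> \<kappa> \<rho> \<rho>0 h p \<xi>"
    and "is_arg_min (dual_objective \<gamma> \<kappa> (leb_density \<Xi> (uniform_density \<Xi> \<rho>0)) h (leb_density \<Xi> p))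
        (\<lambda>M. M \<in> dual_ball \<Xi> \<rho>) M
      \<longleftrightarrow> M = leb_density \<Xi> (dual_update \<Xi> \<gamma> \<kappa> \<rho> \<rho>0 h p)"
proof -
  let ?N = "restrict_space lborel \<Xi>"
  have \<Xi>_meas [measurable]: "\<Xi> \<in> sets borel" using \<Xi>(1) by (simp add: borel_compact)
  have space: "space ?N = \<Xi>" by (simp add: space_restrict_space)
  have measN: "measure ?N \<Xi> = measure lborel \<Xi>"
    by (simp add: measure_restrict_space)
  have fin: "finite_measure ?N"
    using emeasure_compact_finite[OF \<Xi>(1)]
    by (intro finite_measureI) (simp add: emeasure_restrict_space space_restrict_space)
  interpret finite_measure ?N by (rule fin)
  interpret entropic_step ?N \<gamma> \<kappa> \<rho> "uniform_density \<Xi> \<rho>0" p h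
  proof
    show "log_bounded ?N (uniform_density \<Xi> \<rho>0)"
      using \<Xi> params by (intro log_bounded_continuous) (auto simp: uniform_density_def)
    show "log_bounded ?N p" using \<Xi>(1) p_cont by (rule log_bounded_continuous)
    show "\<exists>B. \<forall>x\<in>space ?N. \<bar>h x\<bar> \<le> B"
      using bounded_continuous_compact[OF \<Xi>(1) h_cont] by (simp add: space_restrict_space)
  qed (use params \<Xi>(2) h_cont in \<open>simp_all add: space measN borel_measurable_continuous_restrict_lborel\<close>)
  have gibbs: "gibbs = (\<lambda>\<xi>. (\<rho>0 / measure lborel \<Xi>) powr (\<gamma> * \<kappa> / (1 + \<gamma> * \<kappa>))
      * (exp (\<gamma> * h \<xi> / (1 + \<gamma> * \<kappa>)) * p \<xi> powr (1 / (1 + \<gamma> * \<kappa>))))"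
    by (rule ext, subst gibbs_def) (simp only: uniform_density_def mult.assoc)
  have "(LINT \<xi>':\<Xi>|lborel. exp (\<gamma> * h \<xi>' / (1 + \<gamma> * \<kappa>)) * p \<xi>' powr (1 / (1 + \<gamma> * \<kappa>)))
      = (\<integral>\<xi>. exp (\<gamma> * h \<xi> / (1 + \<gamma> * \<kappa>)) * p \<xi> powr (1 / (1 + \<gamma> * \<kappa>)) \<partial>?N)"
    by (simp add: set_lebesgue_integral_def integral_restrict_space)
  then have update: "dual_update \<Xi> \<gamma> \<kappa> \<rho> \<rho>0 h p = minimizer"
    by (simp add: fun_eq_iff dual_update_def minimizer_def scaling_def gibbs mult.assoc)
  have "continuous_on \<Xi> (\<lambda>\<xi>. scaling * gibbs \<xi>)"
    unfolding gibbs using h_cont p_cont gk_pos by (intro continuous_intros) force+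
  then show "continuous_on \<Xi> (dual_update \<Xi> \<gamma> \<kappa> \<rho> \<rho>0 h p)"
    by (simp add: update minimizer_def[abs_def])
  show "\<xi> \<in> \<Xi> \<Longrightarrow> 0 < dual_update \<Xi> \<gamma> \<kappa> \<rho> \<rho>0 h p \<xi>"
    using log_boundedD(2)[OF log_bounded_minimizer, of \<xi>] by (simp add: update space)
  have "sets ?N = sets (restrict_space borel \<Xi>)"
    by (simp cong: sets_restrict_space_cong)
  then have "(\<lambda>M. M \<in> dual_ball \<Xi> \<rho>)
      = (\<lambda>M. sets M = sets ?N \<and> finite_measure M \<and> measure M (space M) \<le> \<rho>)"
    by (auto simp: dual_ball_def nonneg_measures_def tv_norm_def fun_eq_iff)
  then show "is_arg_min (dual_objective \<gamma> \<kappa> (leb_density \<Xi> (uniform_density \<Xi> \<rho>0)) h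
        (leb_density \<Xi> p)) (\<lambda>M. M \<in> dual_ball \<Xi> \<rho>) M
      \<longleftrightarrow> M = leb_density \<Xi> (dual_update \<Xi> \<gamma> \<kappa> \<rho> \<rho>0 h p)"
    using is_arg_min_iff by (simp add: leb_density_def update)
qed

theorem theorem4p1:
  fixes X :: "(real^'m) set" and \<Xi> :: "(real^'d) set"
    and f :: "real^'m \<Rightarrow> real" and gradf :: "real^'m \<Rightarrow> real^'m"
    and g :: "real^'m \<Rightarrow> real^'d \<Rightarrow> real"
    and Lf LgX Lg\<Xi> \<theta> \<rho> \<rho>0 \<gamma> \<kappa> :: real
    and xt :: "real^'m"
    and x :: "nat \<Rightarrow> real^'m" and \<G> :: "nat \<Rightarrow> real^'m"
    and \<Lambda> :: "nat \<Rightarrow> (real^'d) measure" and \<Lambda>u :: "(real^'d) measure"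
    and k :: nat
  assumes X: "convex X" "compact X"
    and f: "convex_on X f" "Lf-lipschitz_on X f" "gradient_on X f gradf"
    and \<Xi>: "compact \<Xi>" "convex \<Xi>" "aff_dim \<Xi> = int DIM(real^'d)"
    and g_x: "\<And>\<xi>. \<xi> \<in> \<Xi> \<Longrightarrow> convex_on X (\<lambda>y. g y \<xi>)"
      "\<And>\<xi>. \<xi> \<in> \<Xi> \<Longrightarrow> LgX-lipschitz_on X (\<lambda>y. g y \<xi>)"
      "\<And>\<xi>. \<xi> \<in> \<Xi> \<Longrightarrow> C1_on X (\<lambda>y. g y \<xi>)"
    and g_\<xi>: "\<And>y. y \<in> X \<Longrightarrow> Lg\<Xi>-lipschitz_on \<Xi> (g y)"
    and primal_solvable: "\<exists>xs. is_arg_min f (feasible X \<Xi> g) xs"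
    and slater: "xt \<in> X" "\<And>\<xi>. \<xi> \<in> \<Xi> \<Longrightarrow> g xt \<xi> < 0"
    and \<theta>: "\<theta> > 0"
    and \<rho>: "\<rho> = rho_bar X \<Xi> f g xt \<theta>"
    and \<rho>0: "0 < \<rho>0" "\<rho>0 \<le> \<rho>"
    and \<Lambda>u: "\<Lambda>u = leb_density \<Xi> (uniform_density \<Xi> \<rho>0)"
    and \<gamma>: "\<gamma> > 0" and \<kappa>: "0 < \<kappa>" "\<kappa> \<le> 1"
    and init: "x 0 \<in> X" "\<Lambda> 0 = \<Lambda>u"
    and primal_step: "\<And>j. j < k \<Longrightarrow>
      is_arg_min (primal_objective \<gamma> (x j) (gradf (x j) + \<G> j)) (\<lambda>y. y \<in> X) (x (Suc j))"
    and dual_step: "\<And>j. j < k \<Longrightarrow>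
      is_arg_min (dual_objective \<gamma> \<kappa> \<Lambda>u (g (x j)) (\<Lambda> j)) (\<lambda>M. M \<in> dual_ball \<Xi> \<rho>) (\<Lambda> (Suc j))"
  shows "continuous_on \<Xi> (dual_density \<Xi> g \<gamma> \<kappa> \<rho> \<rho>0 x k)
    \<and> (\<forall>\<xi>\<in>\<Xi>. dual_density \<Xi> g \<gamma> \<kappa> \<rho> \<rho>0 x k \<xi> > 0)
    \<and> \<Lambda> k = leb_density \<Xi> (dual_density \<Xi> g \<gamma> \<kappa> \<rho> \<rho>0 x k)
    \<and> (\<forall>M. is_arg_min (dual_objective \<gamma> \<kappa> \<Lambda>u (g (x k)) (\<Lambda> k)) (\<lambda>M. M \<in> dual_ball \<Xi> \<rho>) M \<longleftrightarrow>
           M = leb_density \<Xi> (dual_update \<Xi> \<gamma> \<kappa> \<rho> \<rho>0 (g (x k)) (dual_density \<Xi> g \<gamma> \<kappa> \<rho> \<rho>0 x k)))"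
proof -
  have vol: "0 < measure lborel \<Xi>" using \<Xi> by (rule convex_full_dim_measure_pos)
  have x_in: "x j \<in> X" if "j \<le> k" for j
    using that init(1) primal_step[of "j - 1"] by (cases j) (auto simp: is_arg_min_def)
  then have cont_g: "continuous_on \<Xi> (g (x j))" if "j \<le> k" for j
    using g_\<xi> that lipschitz_on_continuous_on by blast
  let ?p = "dual_density \<Xi> g \<gamma> \<kappa> \<rho> \<rho>0 x"
  have "0 < \<rho>" using \<rho>0 by simp
  note update = dual_update_characterisation[OF \<Xi>(1) vol \<gamma> \<kappa>(1) this \<rho>0(1)]
  \<comment> \<open>The dual steps only say that \<open>\<Lambda> (Suc j)\<close> is some minimiser; uniqueness makes it the one with
      the stated density.\<close>
  have inv: "continuous_on \<Xi> (?p j) \<and> (\<forall>\<xi>\<in>\<Xi>. 0 < ?p j \<xi>) \<and> \<Lambda> j = leb_density \<Xi> (?p j)"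
    if "j \<le> k" for j
    using that
  proof (induction j)
    case 0
    then show ?case
      using vol \<rho>0(1) by (simp add: init(2) \<Lambda>u uniform_density_def[abs_def])
  next
    case (Suc j)
    then have IH: "continuous_on \<Xi> (?p j)" "\<And>\<xi>. \<xi> \<in> \<Xi> \<Longrightarrow> 0 < ?p j \<xi>"
        "\<Lambda> j = leb_density \<Xi> (?p j)" and "j < k" by auto
    note up = update[OF cont_g IH(1,2)]
    have "\<Lambda> (Suc j) = leb_density \<Xi> (?p (Suc j))"
      using dual_step[OF \<open>j < k\<close>] up(3)[of j] \<open>j < k\<close> by (simp add: IH(3) \<Lambda>u)
    with up(1,2)[of j] \<open>j < k\<close> show ?case by simp
  qed
  then have now: "continuous_on \<Xi> (?p k)" "\<And>\<xi>. \<xi> \<in> \<Xi> \<Longrightarrow> 0 < ?p k \<xi>"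
      "\<Lambda> k = leb_density \<Xi> (?p k)" by auto
  with update(3)[OF cont_g[OF order_refl] now(1,2)] show ?thesis
    by (simp add: \<Lambda>u)
qed

end
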